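(* Let $S\subseteq\mathbb{Z}^2$ and let $\alpha,\beta$ be reals with $\beta\le 3\cdot 2-3=3$. Then $\vartheta(R(S),\alpha,\beta+2)\ge\vartheta(S,\alpha,\beta)$.
   Context: Graph $\mathbf{G}$ on $\mathbb{Z}^2$: each $p$ is adjacent to $p\pm(1,0)$, $p\pm(0,1)$, $p+(-1,1)$, $p+(1,-1)$; connectedness and paths refer to $\mathbf{G}$ (paths "in $S$" use only vertices of $S$). Tiles: $Q(p)=\{p,p+(1,0),p+(0,1)\}$; $R(S)=\{p:|S\cap Q(p)|\ge 2\}$ (Toom's rule). Triangles: for reals $a,b,c$, $L(a,b,c)=\{(x,y): -x\le a,\ -y\le b,\ x+y\le c\}$, $\mathrm{span}(L(a,b,c))=a+b+c$, $D(L(a,b,c),d)=L(a-d,b-d,c-d)$. For $E\subseteq\mathbb{Z}^2$, $\mathrm{span}(E,d)$ is the minimum of $\sum_{I\in\mathcal{I}}\mathrm{span}(I)$ over finite sets $\mathcal{I}$ of triangles with $E\subseteq\bigcup_{I\in\mathcal{I}}D(I,d)$, and $\mathrm{Span}(E)=\mathrm{span}(E,2)$ (the deflation constant is $2$). A triple $(C,A_1,A_2)$ of pairwise disjoint subsets of $S$ is a cut of $S$ with parameters $|C|,m$ if every path in $S$ from $A_1$ to $A_2$ passes through an element of $C$, and $m=\min_{j=1,2}\mathrm{Span}(A_j\cup C)$; it is connected if both $A_1\cup C$ and $A_2\cup C$ are connected. $\vartheta(S,\alpha,\beta)$ is the smallest $k$ such that $S$ has a connected cut with parameters $k,m$ with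 $m>\alpha k+\beta$ ($\infty$ if none). *)

theory Defs
  imports Main "HOL-Library.Extended_Real" "HOL-Library.Extended_Nat"
begin

type_synonym pt = "int \<times> int"

definition adj :: "pt \<Rightarrow> pt \<Rightarrow> bool" where
  "adj p q \<longleftrightarrow> (fst q - fst p, snd q - snd p) \<in>
     {(1,0), (-1,0), (0,1), (0,-1), (-1,1), (1,-1)}"

definition path_in :: "pt set \<Rightarrow> pt list \<Rightarrow> bool" where
  "path_in S ps \<longleftrightarrow> ps \<noteq> [] \<and> set ps \<subseteq> S \<and>
     (\<forall>i. Suc i < length ps \<longrightarrow> adj (ps ! i) (ps ! Suc i))"

definition connected_set :: "pt set \<Rightarrow> bool" where
  "connected_set S \<longleftrightarrow> (\<forall>p\<in>S. \<forall>q\<in>S. \<exists>ps. path_in S ps \<and> hd ps = p \<and> last ps = q)"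

definition tile :: "pt \<Rightarrow> pt set" where
  "tile p = {p, (fst p + 1, snd p), (fst p, snd p + 1)}"

definition toom :: "pt set \<Rightarrow> pt set" where
  "toom S = {p. card (S \<inter> tile p) \<ge> 2}"

text \<open>Triangle L(a,b,c) (as a set of real points); triangles are represented by
  their parameters (a,b,c) with a+b+c \<ge> 0 (nonempty triangles).\<close>
definition Ltri :: "real \<Rightarrow> real \<Rightarrow> real \<Rightarrow> (real \<times> real) set" where
  "Ltri a b c = {(x,y). -x \<le> a \<and> -y \<le> b \<and> x + y \<le> c}"

definition is_triangle :: "real \<times> real \<times> real \<Rightarrow> bool" where
  "is_triangle t \<longleftrightarrow> (case t of (a,b,c) \<Rightarrow> a + b + c \<ge> 0)"

definition tspan :: "real \<times> real \<times> real \<Rightarrow> real" where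
  "tspan t = (case t of (a,b,c) \<Rightarrow> a + b + c)"

definition deflate :: "real \<times> real \<times> real \<Rightarrow> real \<Rightarrow> (real \<times> real) set" where
  "deflate t d = (case t of (a,b,c) \<Rightarrow> Ltri (a - d) (b - d) (c - d))"

definition span_d :: "pt set \<Rightarrow> real \<Rightarrow> ereal" where
  "span_d E d = Inf {ereal (\<Sum>t\<in>I. tspan t) | I. finite I \<and> (\<forall>t\<in>I. is_triangle t) \<and>
      (\<forall>p\<in>E. \<exists>t\<in>I. (real_of_int (fst p), real_of_int (snd p)) \<in> deflate t d)}"

definition Span :: "pt set \<Rightarrow> ereal" where
  "Span E = span_d E 2"

definition is_cut :: "pt set \<Rightarrow> pt set \<Rightarrow> pt set \<Rightarrow> pt set \<Rightarrow> bool" where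
  "is_cut S C A1 A2 \<longleftrightarrow> C \<subseteq> S \<and> A1 \<subseteq> S \<and> A2 \<subseteq> S \<and>
     C \<inter> A1 = {} \<and> C \<inter> A2 = {} \<and> A1 \<inter> A2 = {} \<and>
     (\<forall>ps. path_in S ps \<and> hd ps \<in> A1 \<and> last ps \<in> A2 \<longrightarrow> set ps \<inter> C \<noteq> {})"

definition cut_m :: "pt set \<Rightarrow> pt set \<Rightarrow> pt set \<Rightarrow> ereal" where
  "cut_m C A1 A2 = min (Span (A1 \<union> C)) (Span (A2 \<union> C))"

definition connected_cut :: "pt set \<Rightarrow> pt set \<Rightarrow> pt set \<Rightarrow> pt set \<Rightarrow> bool" where
  "connected_cut S C A1 A2 \<longleftrightarrow> is_cut S C A1 A2 \<and>
     connected_set (A1 \<union> C) \<and> connected_set (A2 \<union> C)"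

definition theta :: "pt set \<Rightarrow> real \<Rightarrow> real \<Rightarrow> enat" where
  "theta S \<alpha> \<beta> = Inf {enat k | k. \<exists>C A1 A2. connected_cut S C A1 A2 \<and> finite C \<and>
      card C = k \<and> cut_m C A1 A2 > ereal (\<alpha> * real k + \<beta>)}"

end

(*
  If two triangles contain points whose smallest common triangle has span at most 2, they can be
  merged at a cost of 2, while deflating a single triangle instead of two saves 6.  So a connected
  set E has Span E = w + 6, where w is the span of the smallest triangle containing E.

  Let (C', A1, A2) be a connected cut of toom S.  Let U consist of the points of S in tiles of
  vertices reachable from A1 off C'.  Every edge of S between U and S - U lies in the tile of some
  z in C', and one point of that tile meets all such edges in it; let C collect one such point for
  each z, so card C <= card C'.  Call a connected set P containing n points of C small if
  Span P <= alpha * n + beta.  If all components of U \<union> C are small, merging them bounds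
  Span (A1 \<union> C'), the loss of 2 coming from the passage from points of S to the tiles containing
  them.  Otherwise fix a component K that is not small; each component N of (S - K) \<union> (K \<inter> C)
  gives the connected cut (N \<inter> K, N - K, K - N) of S, so N is small, and merging these components
  bounds Span (A2 \<union> C').
*)

theory Submission
  imports Defs
begin

section \<open>Reachability, components and triangles on lattice points\<close>

definition adj_on :: "pt set \<Rightarrow> (pt \<times> pt) set" where
  "adj_on T = {(p, q). p \<in> T \<and> q \<in> T \<and> adj p q}"

text \<open>For \<open>p\<close> outside \<open>T\<close> this is \<open>{p}\<close>, hence the
  premise of \<open>component_subset\<close>.\<close>

definition component :: "pt set \<Rightarrow> pt \<Rightarrow> pt set" where
  "component T p = (adj_on T)\<^sup>* `` {p}"

text \<open>The trace of \<open>Ltri a b c\<close> on the lattice.\<close>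

definition in_tri :: "real \<Rightarrow> real \<Rightarrow> real \<Rightarrow> pt \<Rightarrow> bool" where
  "in_tri a b c p \<longleftrightarrow> - real_of_int (fst p) \<le> a \<and> - real_of_int (snd p) \<le> b \<and>
     real_of_int (fst p + snd p) \<le> c"

text \<open>The span of the smallest triangle that contains both points.\<close>

definition gap :: "pt \<Rightarrow> pt \<Rightarrow> int" where
  "gap p q = max (- fst p) (- fst q) + max (- snd p) (- snd q) + max (fst p + snd p) (fst q + snd q)"

lemma adj_cases:
  assumes "adj p q"
  obtains e f where "q = (fst p + e, snd p + f)"
    "(e, f) \<in> {(1,0), (-1,0), (0,1), (0,-1), (-1,1), (1,-1)}"
proof (rule that)
  show "q = (fst p + (fst q - fst p), snd p + (snd q - snd p))" by simp
  show "(fst q - fst p, snd q - snd p) \<in> {(1,0), (-1,0), (0,1), (0,-1), (-1,1), (1,-1)}"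
    using assms by (simp only: adj_def)
qed

lemma adj_sym: "adj p q \<Longrightarrow> adj q p"
  by (erule adj_cases) (auto simp: adj_def)

lemma adj_neq: "adj p q \<Longrightarrow> p \<noteq> q"
  by (erule adj_cases) (auto simp: prod_eq_iff)

lemma sym_adj_on_rtrancl: "sym ((adj_on T)\<^sup>*)"
  by (intro sym_rtrancl) (auto simp: sym_def adj_on_def intro: adj_sym)

lemma path_in_Cons:
  "path_in S (p # ps) \<longleftrightarrow> p \<in> S \<and> (ps = [] \<or> path_in S ps \<and> adj p (hd ps))"
proof (cases ps)
  case (Cons r rs)
  have "(\<forall>i. Suc i < length (p # ps) \<longrightarrow> adj ((p # ps) ! i) ((p # ps) ! Suc i)) \<longleftrightarrow>
      adj p r \<and> (\<forall>i. Suc i < length ps \<longrightarrow> adj (ps ! i) (ps ! Suc i))" (is "?l \<longleftrightarrow> ?r")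
  proof
    assume l: ?l
    have "adj p r" using l[rule_format, of 0] Cons by simp
    moreover have "adj (ps ! i) (ps ! Suc i)" if "Suc i < length ps" for i
      using l[rule_format, of "Suc i"] that by simp
    ultimately show ?r by blast
  next
    assume r: ?r
    show ?l
    proof (intro allI impI)
      fix i assume "Suc i < length (p # ps)"
      then show "adj ((p # ps) ! i) ((p # ps) ! Suc i)"
        using r Cons by (cases i) auto
    qed
  qed
  then show ?thesis using Cons by (auto simp: path_in_def)
qed (simp add: path_in_def)

lemma path_in_imp_rtrancl:
  "path_in S ps \<Longrightarrow> (hd ps, last ps) \<in> (adj_on S)\<^sup>*"
proof (induction ps)
  case (Cons p ps)
  show ?case
  proof (cases "ps = []")
    case False
    then have "path_in S ps" "p \<in> S" "adj p (hd ps)" using Cons.prems by (auto simp: path_in_Cons)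
    moreover have "hd ps \<in> S" using \<open>path_in S ps\<close> by (auto simp: path_in_def)
    ultimately have "(p, hd ps) \<in> adj_on S" by (simp add: adj_on_def)
    with Cons.IH[OF \<open>path_in S ps\<close>] False show ?thesis
      by (auto intro: converse_rtrancl_into_rtrancl)
  qed simp
qed (simp add: path_in_def)

lemma rtrancl_imp_path_in:
  assumes "(p, q) \<in> (adj_on S)\<^sup>*" "q \<in> S"
  shows "\<exists>ps. path_in S ps \<and> hd ps = p \<and> last ps = q"
  using assms
proof (induction rule: converse_rtrancl_induct)
  case base
  then show ?case by (intro exI[of _ "[q]"]) (simp add: path_in_def)
next
  case (step p r)
  then obtain ps where "path_in S ps" "hd ps = r" "last ps = q" by blast
  moreover from this(1) have "ps \<noteq> []" by (simp add: path_in_def)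
  ultimately show ?case
    by (intro exI[of _ "p # ps"]) (use step.hyps(1) in \<open>auto simp: path_in_Cons adj_on_def\<close>)
qed

lemma connected_set_iff:
  "connected_set S \<longleftrightarrow> (\<forall>p\<in>S. \<forall>q\<in>S. (p, q) \<in> (adj_on S)\<^sup>*)"
  unfolding connected_set_def
  by (metis path_in_imp_rtrancl rtrancl_imp_path_in)

lemma component_subset: "p \<in> T \<Longrightarrow> component T p \<subseteq> T"
proof -
  assume "p \<in> T"
  have "q \<in> T" if "(p, q) \<in> (adj_on T)\<^sup>*" for q
    using that \<open>p \<in> T\<close> by (induction rule: rtrancl_induct) (auto simp: adj_on_def)
  then show ?thesis by (auto simp: component_def)
qed

lemma component_self: "p \<in> component T p"
  by (simp add: component_def)

lemma component_closed:
  "q \<in> component T p \<Longrightarrow> p \<in> T \<Longrightarrow> r \<in> T \<Longrightarrow> adj q r \<Longrightarrow> r \<in> component T p"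
  using component_subset[of p T]
  by (auto simp: component_def adj_on_def intro: rtrancl_into_rtrancl)

lemma component_eq: "q \<in> component T p \<Longrightarrow> component T q = component T p"
  unfolding component_def using sym_adj_on_rtrancl[of T]
  by (auto dest: symD intro: rtrancl_trans)

text \<open>A path from \<open>p\<close> in \<open>T\<close> visits only vertices reachable from
  \<open>p\<close>, so it stays in the component; any two vertices are then joined through
  \<open>p\<close>.\<close>

lemma connected_component:
  assumes "p \<in> T"
  shows "connected_set (component T p)"
proof -
  have *: "(p, q) \<in> (adj_on (component T p))\<^sup>*" if "(p, q) \<in> (adj_on T)\<^sup>*" for q
    using that
  proof (induction rule: rtrancl_induct)
    case (step q r)
    have "q \<in> component T p" "r \<in> component T p"
      using step.hyps by (auto simp: component_def intro: rtrancl_into_rtrancl)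
    then have "(q, r) \<in> adj_on (component T p)"
      using step.hyps by (auto simp: adj_on_def)
    with step.IH show ?case by (rule rtrancl_into_rtrancl)
  qed simp
  show ?thesis unfolding connected_set_iff
  proof (intro ballI)
    fix q r assume "q \<in> component T p" "r \<in> component T p"
    then have "(p, q) \<in> (adj_on (component T p))\<^sup>*" "(p, r) \<in> (adj_on (component T p))\<^sup>*"
      using * by (auto simp: component_def)
    then show "(q, r) \<in> (adj_on (component T p))\<^sup>*"
      by (meson rtrancl_trans symD sym_adj_on_rtrancl)
  qed
qed

text \<open>A walk from \<open>p\<close> to \<open>q\<close> inside \<open>E\<close> has to leave
  \<open>P\<close> along some edge.\<close>

lemma connected_crossing_edge:
  assumes "connected_set E" "p \<in> E" "q \<in> E" "P p" "\<not> P q"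
  obtains x y where "x \<in> E" "y \<in> E" "adj x y" "P x" "\<not> P y"
proof -
  have "(p, q) \<in> (adj_on E)\<^sup>*" using assms by (auto simp: connected_set_iff)
  then have "\<not> P q \<longrightarrow> (\<exists>x y. x \<in> E \<and> y \<in> E \<and> adj x y \<and> P x \<and> \<not> P y)"
    using \<open>P p\<close> by (induction rule: rtrancl_induct) (auto simp: adj_on_def)
  with assms(5) that show thesis by blast
qed

section \<open>Tiles and adjacency\<close>

text \<open>The vertices whose tiles contain \<open>u\<close> are \<open>u\<close>,
  \<open>u - (1,0)\<close> and \<open>u - (0,1)\<close>, and these are pairwise adjacent.\<close>

lemma tiles_meet:
  assumes "u \<in> tile x" "u \<in> tile y"
  shows "x = y \<or> adj x y"
proof -
  have "x = u \<or> x = (fst u - 1, snd u) \<or> x = (fst u, snd u - 1)" if "u \<in> tile x" for x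
    using that by (auto simp: tile_def prod_eq_iff)
  from this[OF assms(1)] this[OF assms(2)] show ?thesis
    by (elim disjE) (simp_all add: adj_def)
qed

lemma edge_in_tile:
  assumes "adj u v"
  obtains z where "u \<in> tile z" "v \<in> tile z"
  using assms
proof (rule adj_cases)
  fix e f
  assume v: "v = (fst u + e, snd u + f)"
    and ef: "(e, f) \<in> {(1,0), (-1,0), (0,1), (0,-1), (-1,1), (1,-1)}"
  show thesis
    \<comment> \<open>The coordinatewise minimum of the endpoints is the corner of a tile containing
      the edge.\<close>
    using ef by (intro that[of "(min (fst u) (fst v), min (snd u) (snd v))"])
      (auto simp: v tile_def prod_eq_iff)
qed

lemma finite_tile: "finite (tile p)"
  by (simp add: tile_def)

lemma in_toomI:
  assumes "u \<in> S" "v \<in> S" "u \<noteq> v" "u \<in> tile z" "v \<in> tile z"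
  shows "z \<in> toom S"
proof -
  have "card {u, v} \<le> card (S \<inter> tile z)"
    using assms finite_tile by (intro card_mono) auto
  with assms(3) show ?thesis by (simp add: toom_def)
qed

lemma toomE:
  assumes "z \<in> toom S"
  obtains u where "u \<in> S" "u \<in> tile z"
proof -
  have "S \<inter> tile z \<noteq> {}" using assms by (auto simp: toom_def)
  with that show thesis by blast
qed

text \<open>The tiles of two adjacent vertices fit into one triangle of span 2, and the gap of two
  points is at most the span of any triangle containing both.\<close>

lemma gap_tiles:
  assumes "adj x y" "u \<in> tile x" "v \<in> tile y"
  shows "gap u v \<le> 2"
  using assms(1)
proof (rule adj_cases)
  fix e f
  assume y: "y = (fst x + e, snd x + f)"
    and ef: "(e, f) \<in> {(1,0), (-1,0), (0,1), (0,-1), (-1,1), (1,-1)}"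
  show ?thesis
    using ef assms(2,3) unfolding y tile_def gap_def
    by (elim insertE emptyE) simp_all
qed

text \<open>Adjacent points even have gap 1; the bound 2 is the form that
  \<open>merge_connected_family\<close> shares between points and tile representatives.\<close>

lemma gap_adj: "adj p q \<Longrightarrow> gap p q \<le> 2"
  by (rule gap_tiles[of p q]) (auto simp: tile_def)

section \<open>Merging triangles\<close>

text \<open>The slacks of \<open>p\<close> in its three inequalities, such as
  \<open>a + fst p\<close>, add up to \<open>a + b + c\<close> because the coordinates cancel;
  likewise for \<open>q\<close>. Moving each side of the smallest triangle around \<open>p\<close>
  and \<open>q\<close> outwards by both slacks covers both triangles.\<close>

lemma merge_triangles:
  assumes "in_tri a b c p" "in_tri a' b' c' q" "gap p q \<le> 2"
  shows "max a a' + max b b' + max c c' \<le> (a + b + c) + (a' + b' + c') + 2"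
proof -
  have g: "max (- real_of_int (fst p)) (- real_of_int (fst q)) +
      max (- real_of_int (snd p)) (- real_of_int (snd q)) +
      max (real_of_int (fst p + snd p)) (real_of_int (fst q + snd q)) \<le> 2"
  proof -
    have "real_of_int (gap p q) \<le> 2" using assms(3) by linarith
    then show ?thesis unfolding gap_def of_int_add of_int_max of_int_minus by simp
  qed
  have 1: "max a a' \<le> max (- real_of_int (fst p)) (- real_of_int (fst q)) + (a + fst p) + (a' + fst q)"
    using assms(1,2) unfolding in_tri_def by linarith
  have 2: "max b b' \<le> max (- real_of_int (snd p)) (- real_of_int (snd q)) + (b + snd p) + (b' + snd q)"
    using assms(1,2) unfolding in_tri_def by linarith
  have 3: "max c c' \<le> max (real_of_int (fst p + snd p)) (real_of_int (fst q + snd q)) +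
      (c - (fst p + snd p)) + (c' - (fst q + snd q))"
    using assms(1,2) unfolding in_tri_def by linarith
  show ?thesis using g 1 2 3 by linarith
qed

lemma in_tri_mono: "in_tri a b c p \<Longrightarrow> a \<le> a' \<Longrightarrow> b \<le> b' \<Longrightarrow> c \<le> c' \<Longrightarrow> in_tri a' b' c' p"
  unfolding in_tri_def by linarith

text \<open>Starting from one index, a crossing edge of \<open>E\<close> always offers a new
  triangle within gap 2 of the merged one. Merging \<open>n\<close> triangles costs
  \<open>2 * (n - 1)\<close>, which is why 2 stands on the left and in every summand. The map
  \<open>u\<close> is the identity for covers of \<open>E\<close> and a tile representative for
  Toom's rule.\<close>

lemma merge_connected_family:
  fixes f :: "pt \<Rightarrow> 'i" and A B D :: "'i \<Rightarrow> real" and u :: "pt \<Rightarrow> pt"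
  assumes conn: "connected_set E" and "E \<noteq> {}" and fin: "finite (f ` E)"
    and inside: "\<And>p. p \<in> E \<Longrightarrow> in_tri (A (f p)) (B (f p)) (D (f p)) (u p)"
    and close: "\<And>p q. p \<in> E \<Longrightarrow> q \<in> E \<Longrightarrow> adj p q \<Longrightarrow> gap (u p) (u q) \<le> 2"
  obtains a b c where "\<forall>p\<in>E. in_tri a b c (u p)"
    "a + b + c + 2 \<le> (\<Sum>i\<in>f ` E. A i + B i + D i + 2)"
proof -
  have grow: "\<exists>Y a b c. Y \<subseteq> f ` E \<and> card Y = Suc n \<and> (\<forall>i\<in>Y. A i \<le> a \<and> B i \<le> b \<and> D i \<le> c) \<and>
      a + b + c + 2 \<le> (\<Sum>i\<in>Y. A i + B i + D i + 2)" if "Suc n \<le> card (f ` E)" for n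
    using that
  proof (induction n)
    case 0
    obtain p where "p \<in> E" using \<open>E \<noteq> {}\<close> by blast
    then show ?case
      by (intro exI[of _ "{f p}"] exI[of _ "A (f p)"] exI[of _ "B (f p)"] exI[of _ "D (f p)"]) auto
  next
    case (Suc n)
    then obtain Y a b c where Y: "Y \<subseteq> f ` E" "card Y = Suc n"
      and le: "\<forall>i\<in>Y. A i \<le> a \<and> B i \<le> b \<and> D i \<le> c"
      and sum: "a + b + c + 2 \<le> (\<Sum>i\<in>Y. A i + B i + D i + 2)" by auto
    have "finite Y" using Y(1) fin by (rule finite_subset)
    have "Y \<noteq> f ` E" using Y(2) Suc.prems by auto
    then obtain q where q: "q \<in> E" "f q \<notin> Y" using Y(1) by blast
    have "Y \<noteq> {}" using Y(2) by auto
    then obtain p where p: "p \<in> E" "f p \<in> Y" using Y(1) by blast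
    obtain x y where xy: "x \<in> E" "y \<in> E" "adj x y" "f x \<in> Y" "f y \<notin> Y"
      using connected_crossing_edge[OF conn p(1) q(1), of "\<lambda>x. f x \<in> Y"] p(2) q(2) by blast
    have "in_tri a b c (u x)"
      using inside[OF xy(1)] le xy(4) by (blast intro: in_tri_mono)
    then have m: "max a (A (f y)) + max b (B (f y)) + max c (D (f y)) \<le>
        (a + b + c) + (A (f y) + B (f y) + D (f y)) + 2"
      using inside[OF xy(2)] close[OF xy(1-3)] by (rule merge_triangles)
    show ?case
    proof (intro exI conjI)
      show "insert (f y) Y \<subseteq> f ` E" using Y(1) xy(2) by blast
      show "card (insert (f y) Y) = Suc (Suc n)" using \<open>finite Y\<close> Y(2) xy(5) by simp
      show "\<forall>i\<in>insert (f y) Y. A i \<le> max a (A (f y)) \<and> B i \<le> max b (B (f y)) \<and> D i \<le> max c (D (f y))"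
        using le by (auto simp: le_max_iff_disj)
      show "max a (A (f y)) + max b (B (f y)) + max c (D (f y)) + 2 \<le>
          (\<Sum>i\<in>insert (f y) Y. A i + B i + D i + 2)"
        using m sum \<open>finite Y\<close> xy(5) by simp
    qed
  qed
  have "card (f ` E) \<noteq> 0" using \<open>E \<noteq> {}\<close> fin by simp
  then obtain n where n: "card (f ` E) = Suc n" using not0_implies_Suc by blast
  obtain Y a b c where Y: "Y \<subseteq> f ` E" "card Y = card (f ` E)"
    and le: "\<forall>i\<in>Y. A i \<le> a \<and> B i \<le> b \<and> D i \<le> c"
    and sum: "a + b + c + 2 \<le> (\<Sum>i\<in>Y. A i + B i + D i + 2)"
    using grow[of n] unfolding n by auto
  have "Y = f ` E" using Y fin by (simp add: card_subset_eq)
  show thesis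
  proof (rule that)
    show "\<forall>p\<in>E. in_tri a b c (u p)"
      using inside le \<open>Y = f ` E\<close> by (blast intro: in_tri_mono)
    show "a + b + c + 2 \<le> (\<Sum>i\<in>f ` E. A i + B i + D i + 2)" using sum \<open>Y = f ` E\<close> by simp
  qed
qed

section \<open>The span of a connected set\<close>

lemma in_deflate_iff:
  "(real_of_int (fst p), real_of_int (snd p)) \<in> deflate (a, b, c) d \<longleftrightarrow> in_tri (a - d) (b - d) (c - d) p"
  by (simp add: deflate_def Ltri_def in_tri_def)

lemma Span_le:
  assumes "\<And>p. p \<in> E \<Longrightarrow> in_tri a b c p" "E \<noteq> {}"
  shows "Span E \<le> ereal (a + b + c + 6)"
  unfolding Span_def span_d_def
proof (rule Inf_lower, rule CollectI, intro exI conjI)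
  obtain p where "p \<in> E" using assms(2) by blast
  from assms(1)[OF this] have "a + b + c \<ge> 0" by (auto simp: in_tri_def)
  \<comment> \<open>Moving each of the three sides outwards by 2 undoes the deflation; this is the
    6.\<close>
  then show "\<forall>t\<in>{(a + 2, b + 2, c + 2)}. is_triangle t" by (simp add: is_triangle_def)
  show "ereal (a + b + c + 6) = ereal (\<Sum>t\<in>{(a + 2, b + 2, c + 2)}. tspan t)" by (simp add: tspan_def)
  show "\<forall>p\<in>E. \<exists>t\<in>{(a + 2, b + 2, c + 2)}.
      (real_of_int (fst p), real_of_int (snd p)) \<in> deflate t 2"
    using assms(1) by (simp add: in_deflate_iff)
qed simp

lemma Span_empty_le: "Span {} \<le> 0"
  unfolding Span_def span_d_def
  by (rule Inf_lower, rule CollectI, rule exI[of _ "{}"]) (simp add: zero_ereal_def)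

lemma Span_nonneg: "0 \<le> Span E"
  unfolding Span_def span_d_def
  by (rule Inf_greatest) (auto simp: is_triangle_def tspan_def zero_ereal_def intro!: sum_nonneg)

text \<open>Each triangle in use loses 6 by deflation and gains 2 by merging. The net saving of 4,
  for at least one triangle, adds to the 2 of the merging lemma and gives 6.\<close>

lemma cover_connected:
  assumes "connected_set E" "E \<noteq> {}" "finite I" "\<forall>t\<in>I. is_triangle t"
    and cov: "\<forall>p\<in>E. \<exists>t\<in>I. (real_of_int (fst p), real_of_int (snd p)) \<in> deflate t 2"
  obtains a b c where "\<forall>p\<in>E. in_tri a b c p" "a + b + c + 6 \<le> (\<Sum>t\<in>I. tspan t)"
proof -
  obtain f where f: "\<And>p. p \<in> E \<Longrightarrow> f p \<in> I \<and> (real_of_int (fst p), real_of_int (snd p)) \<in> deflate (f p) 2"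
    using cov by metis
  have sub: "f ` E \<subseteq> I" using f by blast
  have fin: "finite (f ` E)" using sub \<open>finite I\<close> by (rule finite_subset)
  obtain a b c where abc: "\<forall>p\<in>E. in_tri a b c p"
    "a + b + c + 2 \<le> (\<Sum>t\<in>f ` E. (fst t - 2) + (fst (snd t) - 2) + (snd (snd t) - 2) + 2)"
  proof (rule merge_connected_family[OF assms(1,2) fin])
    show "in_tri (fst (f p) - 2) (fst (snd (f p)) - 2) (snd (snd (f p)) - 2) p" if "p \<in> E" for p
      using f[OF that] by (cases "f p") (simp add: in_deflate_iff)
  qed (auto intro: gap_adj)
  have "(\<Sum>t\<in>f ` E. (fst t - 2) + (fst (snd t) - 2) + (snd (snd t) - 2) + 2) =
      (\<Sum>t\<in>f ` E. tspan t - 4)"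
    by (intro sum.cong) (simp_all add: tspan_def case_prod_beta)
  also have "\<dots> = (\<Sum>t\<in>f ` E. tspan t) - 4 * real (card (f ` E))"
    by (simp add: sum_subtractf)
  also have "\<dots> \<le> (\<Sum>t\<in>I. tspan t) - 4"
  proof -
    have "(\<Sum>t\<in>f ` E. tspan t) \<le> (\<Sum>t\<in>I. tspan t)"
      using assms(3,4) sub by (intro sum_mono2) (auto simp: is_triangle_def tspan_def)
    moreover have "card (f ` E) \<ge> 1" using fin assms(2) by (simp add: Suc_le_eq card_gt_0_iff)
    ultimately show ?thesis by simp
  qed
  finally have "a + b + c + 6 \<le> (\<Sum>t\<in>I. tspan t)" using abc(2) by linarith
  with abc(1) show thesis by (rule that)
qed

text \<open>Minimising a natural number, the distance of \<open>f p\<close> from the bound,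
  maximises \<open>f\<close> even before \<open>E\<close> is known to be finite.\<close>

lemma bounded_int_max:
  fixes f :: "pt \<Rightarrow> int"
  assumes "E \<noteq> {}" "\<And>p. p \<in> E \<Longrightarrow> real_of_int (f p) \<le> a"
  obtains p where "p \<in> E" "\<And>q. q \<in> E \<Longrightarrow> f q \<le> f p"
proof -
  have le: "f p \<le> \<lfloor>a\<rfloor>" if "p \<in> E" for p using assms(2)[OF that] by (simp add: le_floor_iff)
  obtain p0 where "p0 \<in> E" using assms(1) by blast
  then obtain p where p: "p \<in> E" "\<forall>q. q \<in> E \<longrightarrow> nat (\<lfloor>a\<rfloor> - f p) \<le> nat (\<lfloor>a\<rfloor> - f q)"
    using ex_has_least_nat[of "\<lambda>p. p \<in> E" p0 "\<lambda>p. nat (\<lfloor>a\<rfloor> - f p)"] by blast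
  have "f q \<le> f p" if "q \<in> E" for q using p(2)[rule_format, OF that] le[OF that] le[OF p(1)] by linarith
  with p(1) that show thesis by blast
qed

text \<open>The triangle whose sides pass through extremal points of \<open>E\<close> lies in every
  triangle around \<open>E\<close>. Its span plus 6 bounds every cover from below, so no error term
  remains in the infimum.\<close>

lemma Span_connected:
  assumes "connected_set E" "E \<noteq> {}" "Span E \<le> ereal s"
  obtains a b c where "\<forall>p\<in>E. in_tri a b c p" "a + b + c + 6 \<le> s"
proof -
  \<comment> \<open>The slack 1 serves only to find some finite cover, which bounds the coordinates
    on \<open>E\<close>.\<close>
  have "Span E < ereal (s + 1)" using assms(3) by (auto intro: le_less_trans)
  then obtain I where "finite I" "\<forall>t\<in>I. is_triangle t"
    "\<forall>p\<in>E. \<exists>t\<in>I. (real_of_int (fst p), real_of_int (snd p)) \<in> deflate t 2"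
    unfolding Span_def span_d_def Inf_less_iff by blast
  then obtain a0 b0 c0 where abc0: "\<forall>p\<in>E. in_tri a0 b0 c0 p"
    "a0 + b0 + c0 + 6 \<le> (\<Sum>t\<in>I. tspan t)"
    by (rule cover_connected[OF assms(1,2)])
  obtain p1 where p1: "p1 \<in> E" "\<And>q. q \<in> E \<Longrightarrow> - fst q \<le> - fst p1"
    using bounded_int_max[of E "\<lambda>p. - fst p" a0] assms(2) abc0(1) by (auto simp: in_tri_def)
  obtain p2 where p2: "p2 \<in> E" "\<And>q. q \<in> E \<Longrightarrow> - snd q \<le> - snd p2"
    using bounded_int_max[of E "\<lambda>p. - snd p" b0] assms(2) abc0(1) by (auto simp: in_tri_def)
  obtain p3 where p3: "p3 \<in> E" "\<And>q. q \<in> E \<Longrightarrow> fst q + snd q \<le> fst p3 + snd p3"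
    using bounded_int_max[of E "\<lambda>p. fst p + snd p" c0] assms(2) abc0(1) by (auto simp: in_tri_def)
  let ?a = "- real_of_int (fst p1)" and ?b = "- real_of_int (snd p2)"
    and ?c = "real_of_int (fst p3 + snd p3)"
  have "ereal (?a + ?b + ?c + 6) \<le> Span E"
    unfolding Span_def span_d_def
  proof (rule Inf_greatest)
    fix z assume "z \<in> {ereal (\<Sum>t\<in>I. tspan t) | I. finite I \<and> (\<forall>t\<in>I. is_triangle t) \<and>
      (\<forall>p\<in>E. \<exists>t\<in>I. (real_of_int (fst p), real_of_int (snd p)) \<in> deflate t 2)}"
    then obtain I where z: "z = ereal (\<Sum>t\<in>I. tspan t)" and I: "finite I" "\<forall>t\<in>I. is_triangle t"
      "\<forall>p\<in>E. \<exists>t\<in>I. (real_of_int (fst p), real_of_int (snd p)) \<in> deflate t 2" by blast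
    obtain a b c where "\<forall>p\<in>E. in_tri a b c p" and s: "a + b + c + 6 \<le> (\<Sum>t\<in>I. tspan t)"
      by (rule cover_connected[OF assms(1,2) I])
    then have "?a \<le> a" "?b \<le> b" "?c \<le> c" using p1(1) p2(1) p3(1) by (auto simp: in_tri_def)
    with s show "ereal (?a + ?b + ?c + 6) \<le> z" unfolding z by simp
  qed
  also note assms(3)
  finally have le: "?a + ?b + ?c + 6 \<le> s" by simp
  have tri: "in_tri ?a ?b ?c p" if "p \<in> E" for p
    using p1(2)[OF that] p2(2)[OF that] p3(2)[OF that] unfolding in_tri_def by linarith
  from tri have "\<forall>p\<in>E. in_tri ?a ?b ?c p" by blast
  then show thesis using le by (rule that)
qed

text \<open>A triangle with a point in it has span at least 0. With \<open>\<beta> \<le> 3\<close>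
  this rules out small components free of cut vertices.\<close>

lemma Span_connected_ge:
  assumes "connected_set E" "E \<noteq> {}"
  shows "Span E \<ge> 6"
proof (rule ccontr)
  assume "\<not> Span E \<ge> 6"
  then have "Span E < ereal 6" by simp
  then obtain s where s: "Span E < ereal s" "s < 6"
    using ereal_dense2[of "Span E" "ereal 6"] by auto
  have "Span E \<le> ereal s" using s(1) by (rule less_imp_le)
  then obtain a b c where "\<forall>p\<in>E. in_tri a b c p" "a + b + c + 6 \<le> s"
    by (rule Span_connected[OF assms])
  moreover obtain p where "p \<in> E" using assms(2) by blast
  ultimately have "in_tri a b c p" "a + b + c + 6 \<le> s" by blast+
  with s(2) show False unfolding in_tri_def by simp
qed

section \<open>Merging small components along tile representatives\<close>

text \<open>A component with \<open>n\<close> points of \<open>C\<close> lies in a triangle of span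
  at most \<open>\<alpha> * n + \<beta> - 6\<close>. Adjacent vertices of \<open>E\<close> have
  representatives with gap at most 2, so these triangles merge into one containing all
  \<open>u x\<close>; a final enlargement covers \<open>E\<close>.\<close>

lemma Span_tile_reps_le:
  fixes u :: "pt \<Rightarrow> pt" and \<alpha> \<beta> :: real
  assumes E: "connected_set E" "E \<noteq> {}"
    and rep: "\<And>x. x \<in> E \<Longrightarrow> u x \<in> tile x \<and> u x \<in> T"
    and C: "finite C" "card C \<le> k"
    and small: "\<And>p. p \<in> T \<Longrightarrow> Span (component T p) \<le> ereal (\<alpha> * card (component T p \<inter> C) + \<beta>)"
    and "\<alpha> \<ge> 0" "\<beta> \<le> 3"
  shows "Span E \<le> ereal (\<alpha> * k + \<beta> + 2)"
proof -
  let ?f = "\<lambda>x. component T (u x)"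
  \<comment> \<open>Without a point of \<open>C\<close> the bound would be
    \<open>\<beta> \<le> 3\<close>, below the minimum 6.\<close>
  have meets: "?f x \<inter> C \<noteq> {}" if "x \<in> E" for x
  proof
    assume "?f x \<inter> C = {}"
    moreover have "u x \<in> T" using rep[OF that] by blast
    ultimately have "Span (?f x) \<le> ereal \<beta>" using small[of "u x"] by simp
    moreover have "6 \<le> Span (?f x)"
      using connected_component[OF \<open>u x \<in> T\<close>] component_self by (intro Span_connected_ge) blast+
    ultimately have "6 \<le> ereal \<beta>" by (meson order_trans)
    with \<open>\<beta> \<le> 3\<close> show False by simp
  qed
  have disj: "P = P'" if P: "P \<in> ?f ` E" "P' \<in> ?f ` E" "q \<in> P" "q \<in> P'" for P P' q
  proof -
    obtain x y where "P = ?f x" "P' = ?f y" using P(1,2) by blast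
    then show ?thesis using component_eq[of q T "u x"] component_eq[of q T "u y"] P(3,4) by simp
  qed
  \<comment> \<open>Disjoint components with nonempty traces on \<open>C\<close> have distinct
    traces, so finiteness of \<open>C\<close> limits their number.\<close>
  have inj: "inj_on (\<lambda>P. P \<inter> C) (?f ` E)"
    using meets disj by (intro inj_onI) blast
  have fin: "finite (?f ` E)"
    by (rule inj_on_finite[OF inj, of "Pow C"]) (use C in auto)
  have "\<forall>P\<in>?f ` E. \<exists>a b c. (\<forall>p\<in>P. in_tri a b c p) \<and> a + b + c + 6 \<le> \<alpha> * card (P \<inter> C) + \<beta>"
  proof
    fix P assume "P \<in> ?f ` E"
    then obtain x where x: "x \<in> E" "P = ?f x" by blast
    then have "u x \<in> T" using rep by blast
    then have "connected_set P" "P \<noteq> {}" "Span P \<le> ereal (\<alpha> * card (P \<inter> C) + \<beta>)"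
      unfolding x(2) using component_self[of "u x" T] by (auto intro: connected_component small)
    then show "\<exists>a b c. (\<forall>p\<in>P. in_tri a b c p) \<and> a + b + c + 6 \<le> \<alpha> * card (P \<inter> C) + \<beta>"
      by (rule Span_connected) blast
  qed
  then obtain A B D where ABD: "\<forall>P\<in>?f ` E.
      (\<forall>p\<in>P. in_tri (A P) (B P) (D P) p) \<and> A P + B P + D P + 6 \<le> \<alpha> * card (P \<inter> C) + \<beta>"
    unfolding bchoice_iff by blast
  obtain a b c where abc: "\<forall>x\<in>E. in_tri a b c (u x)"
    and le: "a + b + c + 2 \<le> (\<Sum>P\<in>?f ` E. A P + B P + D P + 2)"
  proof (rule merge_connected_family[OF E fin, of A B D u])
    show "in_tri (A (?f x)) (B (?f x)) (D (?f x)) (u x)" if "x \<in> E" for x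
      using ABD that component_self by blast
    show "gap (u x) (u y) \<le> 2" if "x \<in> E" "y \<in> E" "adj x y" for x y
      using gap_tiles that rep by blast
  qed
  \<comment> \<open>The constant is \<open>\<beta> - 6\<close> for the component plus 2 for a
    merge.\<close>
  have "(\<Sum>P\<in>?f ` E. A P + B P + D P + 2) \<le> (\<Sum>P\<in>?f ` E. \<alpha> * card (P \<inter> C) + (\<beta> - 4))"
    using ABD by (intro sum_mono) force
  also have "\<dots> = \<alpha> * (\<Sum>P\<in>?f ` E. card (P \<inter> C)) + card (?f ` E) * (\<beta> - 4)"
    by (simp add: sum.distrib sum_distrib_left)
  also have "(\<Sum>P\<in>?f ` E. card (P \<inter> C)) = card (\<Union>P\<in>?f ` E. P \<inter> C)"
  proof (rule card_UN_disjoint[symmetric, OF fin])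
    show "\<forall>P\<in>?f ` E. finite (P \<inter> C)" using C(1) by simp
    show "\<forall>P\<in>?f ` E. \<forall>P'\<in>?f ` E. P \<noteq> P' \<longrightarrow> (P \<inter> C) \<inter> (P' \<inter> C) = {}"
      using disj by (meson IntE disjoint_iff)
  qed
  also have "\<alpha> * card (\<Union>P\<in>?f ` E. P \<inter> C) \<le> \<alpha> * k"
  proof -
    have "card (\<Union>P\<in>?f ` E. P \<inter> C) \<le> card C" using C(1) by (intro card_mono) auto
    with C(2) \<open>\<alpha> \<ge> 0\<close> show ?thesis by (intro mult_left_mono) auto
  qed
  \<comment> \<open>As \<open>\<beta> - 4 < 0\<close>, a single component is the worst case.\<close>
  also have "card (?f ` E) * (\<beta> - 4) \<le> \<beta> - 4"
  proof -
    have "card (?f ` E) \<ge> 1" using fin E(2) by (simp add: Suc_le_eq card_gt_0_iff)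
    then have "(real (card (?f ` E)) - 1) * (4 - \<beta>) \<ge> 0" using \<open>\<beta> \<le> 3\<close> by simp
    then show ?thesis by (simp add: algebra_simps)
  qed
  finally have sum: "a + b + c + 6 \<le> \<alpha> * k + \<beta>" using le by simp
  \<comment> \<open>Since \<open>u x\<close> is \<open>x\<close>, \<open>x + (1,0)\<close> or
    \<open>x + (0,1)\<close>, two sides move by 1, while the one bounding the coordinate sum
    stays.\<close>
  have "in_tri (a + 1) (b + 1) c x" if "x \<in> E" for x
    using bspec[OF abc that] rep[OF that] by (auto simp: in_tri_def tile_def)
  from Span_le[OF this E(2)] have "Span E \<le> ereal ((a + 1) + (b + 1) + c + 6)" by simp
  also have "\<dots> \<le> ereal (\<alpha> * k + \<beta> + 2)" using sum by simp
  finally show ?thesis .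
qed

section \<open>Pulling a cut back through Toom's rule\<close>

text \<open>A tile has three points, so one of the two classes cut out by \<open>U\<close> has at
  most one element. That element is \<open>w\<close>; if the class is empty, any point of
  \<open>S\<close> in the tile serves.\<close>

lemma edge_splitting_vertex:
  assumes "z \<in> toom S"
  shows "\<exists>w. w \<in> S \<and> w \<in> tile z \<and>
    (\<forall>u v. u \<in> S \<inter> tile z \<and> u \<in> U \<and> v \<in> S \<inter> tile z \<and> v \<notin> U \<longrightarrow> w = u \<or> w = v)"
proof -
  let ?X = "S \<inter> tile z"
  obtain w0 where w0: "w0 \<in> ?X" using assms by (blast elim: toomE)
  have "(\<exists>w\<in>?X. \<forall>u\<in>?X \<inter> U. u = w) \<or> (\<exists>w\<in>?X. \<forall>v\<in>?X - U. v = w)"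
  proof (rule ccontr)
    assume no: "\<not> ?thesis"
    obtain p where p: "p \<in> ?X \<inter> U" using no w0 by blast
    obtain q where q: "q \<in> ?X \<inter> U" "q \<noteq> p" using no p by blast
    obtain r where r: "r \<in> ?X - U" using no w0 by blast
    obtain s where s: "s \<in> ?X - U" "s \<noteq> r" using no r by blast
    have "distinct [p, q, r, s]" using p q r s by auto
    then have "card {p, q, r, s} = 4" using distinct_card by fastforce
    moreover have "card {p, q, r, s} \<le> card (tile z)"
      using p q r s finite_tile by (intro card_mono) auto
    moreover have "card (tile z) = 3" by (simp add: tile_def prod_eq_iff)
    ultimately show False by simp
  qed
  then obtain w where "w \<in> ?X" "(\<forall>u\<in>?X \<inter> U. u = w) \<or> (\<forall>v\<in>?X - U. v = w)" by blast
  then show ?thesis by (intro exI[of _ w]) (metis DiffI IntD1 IntD2 IntI)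
qed

lemma separated_is_cut:
  assumes "C \<subseteq> S" "A \<subseteq> S" "B \<subseteq> S" "C \<inter> A = {}" "C \<inter> B = {}" "A \<inter> B = {}"
    and "\<And>p q. p \<in> A \<Longrightarrow> q \<in> S \<Longrightarrow> adj p q \<Longrightarrow> q \<in> A \<union> C"
  shows "is_cut S C A B"
  unfolding is_cut_def
proof (intro conjI allI impI notI)
  fix ps assume ps: "path_in S ps \<and> hd ps \<in> A \<and> last ps \<in> B" and "set ps \<inter> C = {}"
  then have "path_in (S - C) ps" by (auto simp: path_in_def)
  then have "(hd ps, last ps) \<in> (adj_on (S - C))\<^sup>*" by (rule path_in_imp_rtrancl)
  moreover have "q \<in> A" if "(hd ps, q) \<in> (adj_on (S - C))\<^sup>*" for q
    using that
  proof (induction rule: rtrancl_induct)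
    case (step q r)
    then show ?case using assms(7)[of q r] by (auto simp: adj_on_def)
  qed (use ps in blast)
  ultimately have "last ps \<in> A" by blast
  with ps assms(6) show False by blast
qed (use assms in auto)

text \<open>If the tile of a vertex of \<open>toom S - C'\<close> meets \<open>U\<close>, it shares
  a point with the tile of a reachable vertex; by \<open>tiles_meet\<close> the vertex is reachable
  itself, so \<open>S\<close> meets its tile within \<open>U\<close>. Only tiles of
  \<open>C'\<close> can be split.\<close>

lemma cut_pullback:
  assumes cut: "is_cut (toom S) C' A1 A2" "finite C'"
  obtains u U where
    "\<forall>x\<in>toom S. u x \<in> S \<and> u x \<in> tile x" "U \<subseteq> S"
    "\<forall>x\<in>A1. u x \<in> U" "\<forall>x\<in>A2. u x \<notin> U"
    "\<forall>v\<in>U. \<forall>w\<in>S - U. adj v w \<longrightarrow> v \<in> u ` C' \<or> w \<in> u ` C'"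
proof -
  let ?R = "toom S - C'"
  define V where "V = (adj_on ?R)\<^sup>* `` A1"
  define U where "U = {v \<in> S. \<exists>x\<in>V. v \<in> tile x}"
  have sub: "A1 \<subseteq> ?R" "A2 \<subseteq> ?R" using cut by (auto simp: is_cut_def)
  have V_R: "V \<subseteq> ?R"
  proof
    fix y assume "y \<in> V"
    then obtain x where "x \<in> A1" "(x, y) \<in> (adj_on ?R)\<^sup>*" by (auto simp: V_def)
    from this(2,1) sub(1) show "y \<in> ?R"
      by (induction rule: rtrancl_induct) (auto simp: adj_on_def)
  qed
  have V_closed: "y \<in> V" if "x \<in> V" "y \<in> ?R" "x = y \<or> adj x y" for x y
  proof (cases "x = y")
    case False
    then have "(x, y) \<in> adj_on ?R" using that V_R by (auto simp: adj_on_def)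
    then show ?thesis using that(1) unfolding V_def by (auto intro: rtrancl_into_rtrancl)
  qed (use that in simp)
  have V_A2: "y \<notin> V" if y: "y \<in> A2" for y
  proof
    assume "y \<in> V"
    then obtain x where x: "x \<in> A1" "(x, y) \<in> (adj_on ?R)\<^sup>*" by (auto simp: V_def)
    then obtain ps where ps: "path_in ?R ps" "hd ps = x" "last ps = y"
      using rtrancl_imp_path_in[OF x(2)] y sub(2) by blast
    then have "path_in (toom S) ps" "set ps \<inter> C' = {}" by (auto simp: path_in_def)
    with x(1) y ps cut(1) show False by (auto simp: is_cut_def)
  qed
  have "\<forall>z\<in>toom S. \<exists>w. w \<in> S \<and> w \<in> tile z \<and>
    (\<forall>u v. u \<in> S \<inter> tile z \<and> u \<in> U \<and> v \<in> S \<inter> tile z \<and> v \<notin> U \<longrightarrow> w = u \<or> w = v)"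
    using edge_splitting_vertex by blast
  \<comment> \<open>One choice function has two roles: a representative for every vertex of
    \<open>toom S\<close> and, on \<open>C'\<close>, a point that meets all split edges of the
    tile.\<close>
  then obtain g where g: "\<And>z. z \<in> toom S \<Longrightarrow> g z \<in> S \<and> g z \<in> tile z \<and>
    (\<forall>u v. u \<in> S \<inter> tile z \<and> u \<in> U \<and> v \<in> S \<inter> tile z \<and> v \<notin> U \<longrightarrow> g z = u \<or> g z = v)"
    by metis
  show thesis
  proof (rule that[of g U])
    show "\<forall>x\<in>toom S. g x \<in> S \<and> g x \<in> tile x" using g by blast
    show "U \<subseteq> S" by (auto simp: U_def)
    show "\<forall>x\<in>A1. g x \<in> U"
    proof
      fix x assume x: "x \<in> A1"
      then have "x \<in> V" "x \<in> toom S" using sub(1) by (auto simp: V_def)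
      then show "g x \<in> U" using g[of x] by (auto simp: U_def)
    qed
    show "\<forall>y\<in>A2. g y \<notin> U"
    proof (intro ballI notI)
      fix y assume y: "y \<in> A2"
      assume "g y \<in> U"
      then obtain x where "x \<in> V" "g y \<in> tile x" by (auto simp: U_def)
      moreover have "y \<in> ?R" using y sub(2) by blast
      moreover have "g y \<in> tile y" using g \<open>y \<in> ?R\<close> by blast
      ultimately have "y \<in> V" using tiles_meet V_closed by blast
      with V_A2[OF y] show False by blast
    qed
    show "\<forall>v\<in>U. \<forall>w\<in>S - U. adj v w \<longrightarrow> v \<in> g ` C' \<or> w \<in> g ` C'"
    proof (intro ballI impI)
      fix v w assume vw: "v \<in> U" "w \<in> S - U" "adj v w"
      obtain z where z: "v \<in> tile z" "w \<in> tile z" using edge_in_tile[OF vw(3)] .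
      have "v \<in> S" using vw(1) by (simp add: U_def)
      \<comment> \<open>Both endpoints lie in \<open>S\<close> and in \<open>tile z\<close>, so
        Toom's rule keeps \<open>z\<close>.\<close>
      have zR: "z \<in> toom S" using in_toomI[of v S w z] z vw adj_neq \<open>v \<in> S\<close> by blast
      obtain x where "x \<in> V" "v \<in> tile x" using vw(1) by (auto simp: U_def)
      have "z \<in> C'"
      proof (rule ccontr)
        assume "z \<notin> C'"
        then have "z \<in> V" using V_closed[OF \<open>x \<in> V\<close>, of z] zR tiles_meet[OF \<open>v \<in> tile x\<close> z(1)] by blast
        then have "w \<in> U" using z(2) vw(2) by (auto simp: U_def)
        with vw(2) show False by blast
      qed
      moreover have "g z = v \<or> g z = w" using g[OF zR] vw z \<open>v \<in> S\<close> by blast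
      ultimately show "v \<in> g ` C' \<or> w \<in> g ` C'" by blast
    qed
  qed
qed

section \<open>The bound for a single cut\<close>

text \<open>Cuts of \<open>S\<close> are bounded for all sizes up to \<open>k\<close>, since
  \<open>u\<close> may identify vertices of \<open>C'\<close> and a component may meet only part of
  the image.\<close>

lemma toom_cut_bound:
  fixes \<alpha> \<beta> :: real
  assumes cut: "connected_cut (toom S) C' A1 A2" "finite C'" "card C' = k"
    and bound: "\<And>C B1 B2. connected_cut S C B1 B2 \<Longrightarrow> finite C \<Longrightarrow> card C \<le> k \<Longrightarrow>
      cut_m C B1 B2 \<le> ereal (\<alpha> * card C + \<beta>)"
    and "\<alpha> \<ge> 0" "\<beta> \<le> 3" and ne: "A1 \<union> C' \<noteq> {}" "A2 \<union> C' \<noteq> {}"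
  shows "cut_m C' A1 A2 \<le> ereal (\<alpha> * k + \<beta> + 2)"
proof -
  have is_cut: "is_cut (toom S) C' A1 A2" and conn: "connected_set (A1 \<union> C')" "connected_set (A2 \<union> C')"
    using cut(1) by (auto simp: connected_cut_def)
  obtain u U where u: "\<forall>x\<in>toom S. u x \<in> S \<and> u x \<in> tile x" and "U \<subseteq> S"
    and A1: "\<forall>x\<in>A1. u x \<in> U" and A2: "\<forall>x\<in>A2. u x \<notin> U"
    and sep: "\<forall>v\<in>U. \<forall>w\<in>S - U. adj v w \<longrightarrow> v \<in> u ` C' \<or> w \<in> u ` C'"
    by (rule cut_pullback[OF is_cut cut(2)])
  have sub: "C' \<subseteq> toom S" "A1 \<subseteq> toom S" "A2 \<subseteq> toom S" using is_cut by (auto simp: is_cut_def)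
  define C where "C = u ` C'"
  have C: "finite C" "card C \<le> k" "C \<subseteq> S"
    using cut(2,3) card_image_le u sub(1) unfolding C_def by blast+
  let ?T = "U \<union> C"
  show ?thesis
  proof (cases "\<forall>p\<in>?T. Span (component ?T p) \<le> ereal (\<alpha> * card (component ?T p \<inter> C) + \<beta>)")
    case True
    have "u x \<in> tile x \<and> u x \<in> ?T" if "x \<in> A1 \<union> C'" for x
      using that u A1 sub unfolding C_def by blast
    then have "Span (A1 \<union> C') \<le> ereal (\<alpha> * k + \<beta> + 2)"
      using True \<open>\<alpha> \<ge> 0\<close> \<open>\<beta> \<le> 3\<close> C(1,2) conn(1) ne(1)
      by (intro Span_tile_reps_le[where T = ?T and u = u and C = C]) auto
    then show ?thesis by (auto simp: cut_m_def min_le_iff_disj)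
  next
    case False
    then obtain p where p: "p \<in> ?T"
      and big: "\<not> Span (component ?T p) \<le> ereal (\<alpha> * card (component ?T p \<inter> C) + \<beta>)" by blast
    define K where "K = component ?T p"
    define CK where "CK = K \<inter> C"
    let ?N = "(S - K) \<union> CK"
    have KT: "K \<subseteq> ?T" unfolding K_def using p by (rule component_subset)
    have "?T \<subseteq> S" using \<open>U \<subseteq> S\<close> C(3) by blast
    \<comment> \<open>By \<open>sep\<close>, a neighbour in \<open>S\<close> of such an
      \<open>x\<close> lies in \<open>U\<close> or in \<open>C\<close>, hence in the same
      component.\<close>
    have K_closed: "y \<in> K" if "x \<in> K - CK" "y \<in> S" "adj x y" for x y
    proof -
      have "x \<in> U" "x \<notin> C" using that(1) KT by (auto simp: CK_def)
      then have "y \<in> ?T" using sep that unfolding C_def by blast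
      then show ?thesis using that component_closed[of x ?T p y] p unfolding K_def by blast
    qed
    have CK: "finite CK" "card CK \<le> k"
      using C(1,2) card_mono[of C CK] by (auto simp: CK_def)
    have small: "Span (component ?N q) \<le> ereal (\<alpha> * card (component ?N q \<inter> CK) + \<beta>)"
      if q: "q \<in> ?N" for q
    proof -
      define N where "N = component ?N q"
      have N: "N \<subseteq> ?N" unfolding N_def using q by (rule component_subset)
      let ?D = "N \<inter> CK"
      have NK: "N \<inter> K = ?D" using N by (auto simp: CK_def)
      have D: "finite ?D" "card ?D \<le> card CK" using CK(1) by (auto intro: card_mono)
      have eqs: "(N - ?D) \<union> ?D = N" "(K - ?D) \<union> ?D = K" by (auto simp: CK_def)
      \<comment> \<open>A neighbour of \<open>N - ?D\<close> in \<open>K - CK\<close> would by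
        \<open>K_closed\<close> put a point of \<open>N - ?D\<close> into \<open>K\<close>, but
        \<open>N\<close> meets \<open>K\<close> only in \<open>?D\<close>.\<close>
      have "is_cut S ?D (N - ?D) (K - ?D)"
      proof (rule separated_is_cut)
        fix x y assume x: "x \<in> N - ?D" and y: "y \<in> S" "adj x y"
        have "x \<notin> K" using x NK by blast
        moreover have "x \<in> S" using x N by auto
        ultimately have "y \<notin> K - CK" using K_closed[of y x] adj_sym[OF y(2)] by blast
        then have "y \<in> ?N" using y(1) by blast
        then have "y \<in> N" using x y(2) q component_closed[of x ?N q y] unfolding N_def by blast
        then show "y \<in> (N - ?D) \<union> ?D" by blast
      qed (use N NK KT \<open>?T \<subseteq> S\<close> C(3) in \<open>auto simp: CK_def\<close>)
      moreover have "connected_set N" unfolding N_def using q by (rule connected_component)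
      moreover have "connected_set K" unfolding K_def using p by (rule connected_component)
      ultimately have "connected_cut S ?D (N - ?D) (K - ?D)"
        unfolding connected_cut_def eqs by blast
      then have "cut_m ?D (N - ?D) (K - ?D) \<le> ereal (\<alpha> * card ?D + \<beta>)"
        using bound D CK(2) by (meson order_trans)
      \<comment> \<open>One of \<open>N\<close> and \<open>K\<close> is small. If it were
        \<open>K\<close>, then \<open>card ?D \<le> card CK\<close> and
        \<open>\<alpha> \<ge> 0\<close> would contradict \<open>big\<close>.\<close>
      then have "Span N \<le> ereal (\<alpha> * card ?D + \<beta>) \<or> Span K \<le> ereal (\<alpha> * card ?D + \<beta>)"
        unfolding cut_m_def eqs by (simp add: min_le_iff_disj)
      moreover have "ereal (\<alpha> * card ?D + \<beta>) \<le> ereal (\<alpha> * card (K \<inter> C) + \<beta>)"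
        using D(2) \<open>\<alpha> \<ge> 0\<close> by (simp add: CK_def mult_left_mono)
      ultimately show ?thesis using big unfolding K_def[symmetric] N_def[symmetric]
        by (meson order_trans)
    qed
    \<comment> \<open>A representative inside \<open>K\<close> lies in \<open>U\<close> or
      \<open>C\<close>; here it must lie in \<open>C\<close>, hence in \<open>CK\<close>.\<close>
    have "u x \<in> tile x \<and> u x \<in> ?N" if "x \<in> A2 \<union> C'" for x
    proof -
      have "x \<in> toom S" using that sub by blast
      moreover have "u x \<notin> U \<or> u x \<in> C" using that A2 by (auto simp: C_def)
      ultimately show ?thesis using u KT by (auto simp: CK_def)
    qed
    then have "Span (A2 \<union> C') \<le> ereal (\<alpha> * k + \<beta> + 2)"
      using small \<open>\<alpha> \<ge> 0\<close> \<open>\<beta> \<le> 3\<close> CK conn(2) ne(2)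
      by (intro Span_tile_reps_le[where T = ?N and u = u and C = CK]) auto
    then show ?thesis by (auto simp: cut_m_def min_le_iff_disj)
  qed
qed

section \<open>Signs of the parameters and conclusion\<close>

lemma connected_set_singleton: "connected_set {p}"
  by (simp add: connected_set_iff)

text \<open>With empty sides the path condition is vacuous; such cuts serve to test the signs of
  \<open>\<alpha>\<close> and \<open>\<beta>\<close>.\<close>

lemma connected_cut_no_sides: "C \<subseteq> S \<Longrightarrow> connected_set C \<Longrightarrow> connected_cut S C {} {}"
  by (simp add: connected_cut_def is_cut_def)

theorem theorem3p5:
  fixes S :: "(int \<times> int) set" and \<alpha> \<beta> :: real
  assumes "\<beta> \<le> 3"
  shows "theta (toom S) \<alpha> (\<beta> + 2) \<ge> theta S \<alpha> \<beta>"
proof -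
  have le: "theta S \<alpha> \<beta> \<le> enat k" if "connected_cut S C A1 A2" "finite C" "card C \<le> k"
    "cut_m C A1 A2 > ereal (\<alpha> * real (card C) + \<beta>)" for C A1 A2 k
    unfolding theta_def using that by (intro Inf_lower2[of "enat (card C)"]) auto
  show ?thesis
    unfolding theta_def[of "toom S"]
  proof (rule Inf_greatest, clarify)
    fix C A1 A2
    assume cut: "connected_cut (toom S) C A1 A2" "finite C"
      and m: "cut_m C A1 A2 > ereal (\<alpha> * real (card C) + (\<beta> + 2))"
    show "theta S \<alpha> \<beta> \<le> enat (card C)"
    proof (rule ccontr)
      assume not_le: "\<not> theta S \<alpha> \<beta> \<le> enat (card C)"
      then have bound: "cut_m D B1 B2 \<le> ereal (\<alpha> * real (card D) + \<beta>)"
        if "connected_cut S D B1 B2" "finite D" "card D \<le> card C" for D B1 B2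
        using le[OF that] by (meson not_le_imp_less)
      \<comment> \<open>The empty cut has \<open>cut_m\<close> at least 0 and is bounded by
        \<open>\<beta>\<close>.\<close>
      have "\<beta> \<ge> 0"
        using bound[of "{}" "{}" "{}"] connected_cut_no_sides[of "{}" S] Span_nonneg[of "{}"]
        by (auto simp: cut_m_def connected_set_iff dest: order_trans)
      \<comment> \<open>A one-point cut is within the allowed size and has span at least 6, so
        \<open>6 \<le> \<alpha> + \<beta>\<close>.\<close>
      have nonneg: "\<alpha> \<ge> 0" if "C \<noteq> {}"
      proof -
        have "C \<subseteq> toom S" using cut(1) by (auto simp: connected_cut_def is_cut_def)
        with \<open>C \<noteq> {}\<close> obtain c where "c \<in> toom S" by blast
        then obtain p where "p \<in> S" by (rule toomE)
        moreover have "card C \<ge> 1" using that cut(2) by (simp add: Suc_le_eq card_gt_0_iff)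
        ultimately have "Span {p} \<le> ereal (\<alpha> + \<beta>)"
          using bound[of "{p}" "{}" "{}"] connected_cut_no_sides[of "{p}" S]
          by (simp add: cut_m_def connected_set_singleton)
        moreover have "6 \<le> Span {p}"
          by (rule Span_connected_ge) (simp_all add: connected_set_singleton)
        ultimately have "6 \<le> ereal (\<alpha> + \<beta>)" by (rule order_trans[rotated])
        with \<open>\<beta> \<le> 3\<close> show ?thesis by simp
      qed
      \<comment> \<open>Otherwise \<open>cut_m\<close> is at most 0, while \<open>m\<close> makes it
        exceed \<open>\<beta> + 2\<close>.\<close>
      have ne: "A1 \<union> C \<noteq> {} \<and> A2 \<union> C \<noteq> {}"
      proof (rule ccontr)
        assume "\<not> ?thesis"
        then have "C = {}" "cut_m C A1 A2 \<le> 0"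
          using Span_empty_le by (auto simp: cut_m_def min_le_iff_disj)
        then have "cut_m C A1 A2 \<le> ereal 0" by (simp add: zero_ereal_def)
        then have "ereal (\<alpha> * real (card C) + (\<beta> + 2)) < ereal 0"
          using m by (rule less_le_trans[rotated])
        then have "\<beta> + 2 < 0" using \<open>C = {}\<close> by simp
        with \<open>\<beta> \<ge> 0\<close> show False by simp
      qed
      \<comment> \<open>For \<open>C = {}\<close> the sign of \<open>\<alpha>\<close> is unknown.
        Passing to \<open>max \<alpha> 0\<close> only weakens the bounds on cuts of
        \<open>S\<close>, and the product with \<open>card C\<close> does not change.\<close>
      have "cut_m C A1 A2 \<le> ereal (max \<alpha> 0 * card C + \<beta> + 2)"
      proof (rule toom_cut_bound[OF cut refl])
        fix D B1 B2 assume D: "connected_cut S D B1 B2" "finite D" "card D \<le> card C"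
        note bound[OF D]
        also have "ereal (\<alpha> * card D + \<beta>) \<le> ereal (max \<alpha> 0 * card D + \<beta>)"
          by (simp add: mult_right_mono)
        finally show "cut_m D B1 B2 \<le> ereal (max \<alpha> 0 * card D + \<beta>)" .
      qed (use ne \<open>\<beta> \<le> 3\<close> in auto)
      also have "max \<alpha> 0 * card C = \<alpha> * card C"
        using nonneg by (cases "C = {}") auto
      finally show False using m by (simp add: add.assoc)
    qed
  qed
qed

end
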